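(* Every assignment oblivious protocol $\Pi$ for the game $G_n$ satisfies $c(\Pi)\ge \log_2(n)/2$.
   Context: The game $G_n$ ($n$ a positive integer): Alice receives, as a stream, a permutation $\sigma=(\sigma_1,\dots,\sigma_n)$ of $[n]=\{1,\dots,n\}$ followed by a bit $b\in\{0,1\}$. She has an array $\mathbf{v}=(v_1,\dots,v_n)$ whose cells are initially empty. For each $i<n$, upon receiving $\sigma_i$ she writes a bit in cell $\sigma_i$, which cannot later be changed. Upon receiving $\sigma_n$ and $b$ she writes $b$ in cell $\sigma_n$. Bob receives the completed array $\mathbf{v}\in\{0,1\}^n$ and outputs a set $J\subseteq[n]$ as a function of $\mathbf{v}$. A protocol $\Pi$ is valid if $\sigma_n\in J$ for all $\sigma,b$; its cost $c(\Pi)$ is the maximum of $|J|$ over all $\sigma,b$. Protocols are required to be valid. For a permutation $\sigma$ and $k\in[n]$, let $S_k(\sigma)=\{\ell:\ell\text{ appears before }k\text{ in }\sigma\}$. A protocol is assignment oblivious if, for each location $k$ (other than the last one $\sigma_n$), the bit Alice writes in location $k$ depends only on $k$ and the set $S_k(\sigma)$ (not on the bits written at those locations nor on their order); equivalently, there are families $H_k$ of subsets of $[n]\setminus\{k\}$ such that Alice writes 1 at $k$ iff $S_k(\sigma)\in H_k$. *)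

theory Defs
  imports Complex_Main
begin

definition perms :: "nat \<Rightarrow> nat list set" where
  "perms n = {\<sigma>. distinct \<sigma> \<and> set \<sigma> = {1..n}}"

definition S_before :: "nat list \<Rightarrow> nat \<Rightarrow> nat set" where
  "S_before \<sigma> k = set (takeWhile (\<lambda>x. x \<noteq> k) \<sigma>)"

text \<open>Assignment oblivious Alice strategy: H k A holds iff Alice writes 1 at
  location k when the set of earlier locations is A (i.e. A is in the family H_k).
  Completed array (cells outside [n] are set to False, they carry no information).\<close>
definition arr :: "(nat \<Rightarrow> nat set \<Rightarrow> bool) \<Rightarrow> nat list \<Rightarrow> bool \<Rightarrow> nat \<Rightarrow> bool" where
  "arr H \<sigma> b k =
     (if k = last \<sigma> then b
      else if k \<in> set \<sigma> then H k (S_before \<sigma> k) else False)"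

definition valid :: "nat \<Rightarrow> (nat \<Rightarrow> nat set \<Rightarrow> bool) \<Rightarrow> ((nat \<Rightarrow> bool) \<Rightarrow> nat set) \<Rightarrow> bool" where
  "valid n H B = (\<forall>\<sigma>\<in>perms n. \<forall>b. last \<sigma> \<in> B (arr H \<sigma> b))"

definition cost :: "nat \<Rightarrow> (nat \<Rightarrow> nat set \<Rightarrow> bool) \<Rightarrow> ((nat \<Rightarrow> bool) \<Rightarrow> nat set) \<Rightarrow> nat" where
  "cost n H B = Max ((\<lambda>(\<sigma>, b). card (B (arr H \<sigma> b))) ` (perms n \<times> UNIV))"

end

theory Submission
  imports Defs
begin

text \<open>Choose \<open>x\<^sub>1, x\<^sub>2, \<dots>, x\<^sub>m, y\<close> with \<open>m = \<lfloor>log 2 n\<rfloor>\<close> greedily, halving the pool of candidates at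
  each step, so that the bit Alice writes at \<open>x\<^sub>l\<close> when exactly \<open>x\<^sub>1, \<dots>, x\<^sub>l\<close> and one further
  chosen element \<open>z\<close> have not appeared before does not depend on \<open>z\<close>. Send all other elements
  first, then \<open>x\<^sub>m, \<dots>, x\<^sub>1, y\<close>. Exchanging \<open>y\<close> and \<open>x\<^sub>i\<close> in this order changes no bit at a position
  other than \<open>x\<^sub>i\<close> and \<open>y\<close>, and the bit at \<open>x\<^sub>i\<close> is now free. The bit at \<open>y\<close> takes the same value
  for at least half of the indices \<open>i\<close>, so the corresponding \<open>x\<^sub>i\<close>, together with \<open>y\<close>, are all
  possible last elements for one array.\<close>

lemma majority_bool:
  assumes "finite A"
  obtains c :: bool where "card A \<le> 2 * card {a\<in>A. P a = c}"
proof -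
  have "card {a\<in>A. P a = True} + card {a\<in>A. P a = False} = card A"
    using assms by (subst card_Un_disjoint[symmetric]) (auto intro: arg_cong[where f = card])
  then have "card A \<le> 2 * card {a\<in>A. P a = True} \<or> card A \<le> 2 * card {a\<in>A. P a = False}"
    by linarith
  then show ?thesis using that by blast
qed

text \<open>Induction with \<open>N\<close> and \<open>T\<close> varying separately: the pool
  \<open>T\<close> shrinks to a majority class, while \<open>N\<close> loses only the chosen
  \<open>x\<close>, because rejected candidates are sent early and remain among the locations seen
  before.\<close>

lemma end_homogeneous_sequence:
  fixes H :: "'a \<Rightarrow> 'a set \<Rightarrow> bool"
  assumes "finite T" "2 ^ m \<le> card T"
  shows "\<exists>xs y. length xs = m \<and> distinct (y # xs) \<and> set (y # xs) \<subseteq> T \<and>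
    (\<forall>i<m. \<forall>z\<in>set (drop (Suc i) xs).
       H (xs ! i) (N - set (take (Suc i) xs) - {z}) = H (xs ! i) (N - set (take (Suc i) xs) - {y}))"
  using assms
proof (induction m arbitrary: N T)
  case 0
  then obtain y where "y \<in> T" by fastforce
  then show ?case by (intro exI[of _ "[]"] exI[of _ y]) simp
next
  case (Suc m)
  then have "T \<noteq> {}" by force
  then obtain x where x: "x \<in> T" by blast
  obtain c where c: "card (T - {x}) \<le> 2 * card {z\<in>T - {x}. H x (N - {x} - {z}) = c}"
    using majority_bool[of "T - {x}" "\<lambda>z. H x (N - {x} - {z})"] Suc.prems(1) by blast
  let ?T = "{z\<in>T - {x}. H x (N - {x} - {z}) = c}"
  \<comment> \<open>Removing \<open>x\<close> costs nothing: at least \<open>2 ^ Suc m - 1\<close>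
    candidates remain, an odd number whose half rounds up to \<open>2 ^ m\<close>.\<close>
  have "2 ^ m \<le> card ?T"
    using c Suc.prems x by (simp add: card_Diff_singleton)
  with Suc.IH[of ?T "N - {x}"] Suc.prems(1) obtain xs y where
    IH: "length xs = m" "distinct (y # xs)" "set (y # xs) \<subseteq> ?T"
      "\<And>i z. i < m \<Longrightarrow> z \<in> set (drop (Suc i) xs) \<Longrightarrow>
        H (xs ! i) (N - {x} - set (take (Suc i) xs) - {z}) =
        H (xs ! i) (N - {x} - set (take (Suc i) xs) - {y})"
    by auto
  have "H ((x # xs) ! i) (N - set (take (Suc i) (x # xs)) - {z}) =
      H ((x # xs) ! i) (N - set (take (Suc i) (x # xs)) - {y})"
    if "i < Suc m" "z \<in> set (drop (Suc i) (x # xs))" for i z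
  proof (cases i)
    case 0
    then have "z \<in> ?T" "y \<in> ?T" using that IH(3) by auto
    then show ?thesis using 0 by simp
  next
    case (Suc l)
    then show ?thesis using IH(4)[of l z] that by (simp add: Diff_insert2[of N x, symmetric])
  qed
  moreover have "length (x # xs) = Suc m" "distinct (y # x # xs)" "set (y # x # xs) \<subseteq> T"
    using IH x by auto
  ultimately show ?case by blast
qed

text \<open>The complement form makes the bit at \<open>k\<close> depend only on the set of later
  locations, which is how homogeneity is phrased.\<close>

lemma S_before_append:
  assumes "distinct (as @ k # bs)"
  shows "S_before (as @ k # bs) k = set (as @ k # bs) - insert k (set bs)"
proof -
  have "S_before (as @ k # bs) k = set as"
    using assms unfolding S_before_def by (subst takeWhile_append2) auto
  then show ?thesis using assms by auto
qed

lemma arr_append: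
  assumes "distinct (as @ k # bs)" "bs \<noteq> []"
  shows "arr H (as @ k # bs) b k = H k (set (as @ k # bs) - insert k (set bs))"
  using assms S_before_append[OF assms(1)] by (auto simp: arr_def)

lemma arr_last [simp]: "arr H (as @ [k]) b k = b"
  by (simp add: arr_def)

text \<open>Locations in \<open>R @ as\<close> see the same earlier set in both orders. For those in
  \<open>bs\<close> the one missing end element changes from \<open>y\<close> to \<open>x\<close>,
  which \<open>hom\<close> makes harmless. At \<open>x\<close> and at \<open>y\<close> one order
  ends with a free bit, chosen to match what \<open>H\<close> writes in the other.\<close>

lemma arr_eqI_exchange:
  assumes dist: "distinct (R @ as @ x # bs @ [y])"
    and N: "N = set (R @ as @ x # bs @ [y])"
    and hom: "\<And>us z vs. bs = us @ z # vs \<Longrightarrow>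
      H z (N - insert z (set vs) - {x}) = H z (N - insert z (set vs) - {y})"
    and x: "b' = H x (N - insert x (set bs) - {y})"
    and y: "b = H y (N - insert x (set bs) - {y})"
  shows "arr H (R @ as @ y # bs @ [x]) b' = arr H (R @ as @ x # bs @ [y]) b" (is "?l = ?r")
proof
  fix k
  have dist': "distinct (R @ as @ y # bs @ [x])" using dist by auto
  have N': "N = set (R @ as @ y # bs @ [x])" using N by auto
  consider "k \<notin> N" | "k = x" | "k = y" | "k \<in> set (R @ as)" | "k \<in> set bs"
    using N by auto
  then show "?l k = ?r k"
  proof cases
    case 1
    then show ?thesis unfolding N by (auto simp: arr_def)
  next
    case 2
    have "?r x = H x (N - insert x (set (bs @ [y])))"
      using arr_append[of "R @ as" x "bs @ [y]"] dist N by simp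
    moreover have "?l x = b'"
      using arr_last[of H "R @ as @ y # bs" x] by simp
    moreover have "N - insert x (set (bs @ [y])) = N - insert x (set bs) - {y}" by auto
    ultimately show ?thesis using 2 x by simp
  next
    case 3
    have "?l y = H y (N - insert y (set (bs @ [x])))"
      using arr_append[of "R @ as" y "bs @ [x]"] dist' N' by simp
    moreover have "?r y = b"
      using arr_last[of H "R @ as @ x # bs" y] by simp
    moreover have "N - insert y (set (bs @ [x])) = N - insert x (set bs) - {y}" by auto
    ultimately show ?thesis using 3 y by simp
  next
    case 4
    then obtain us vs where k: "R @ as = us @ k # vs" by (meson split_list)
    then have "R @ as @ x # bs @ [y] = us @ k # vs @ x # bs @ [y]"
      "R @ as @ y # bs @ [x] = us @ k # vs @ y # bs @ [x]"
      by (metis append.assoc append_Cons)+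
    moreover have "insert k (set (vs @ y # bs @ [x])) = insert k (set (vs @ x # bs @ [y]))" by auto
    ultimately show ?thesis
      using arr_append[of us k "vs @ x # bs @ [y]"] arr_append[of us k "vs @ y # bs @ [x]"]
        dist dist' N N' by (metis append_is_Nil_conv list.discI)
  next
    case 5
    then obtain us vs where k: "bs = us @ k # vs" by (meson split_list)
    have "?r k = H k (N - insert k (set (vs @ [y])))"
      using arr_append[of "R @ as @ x # us" k "vs @ [y]"] dist N k by simp
    moreover have "?l k = H k (N - insert k (set (vs @ [x])))"
      using arr_append[of "R @ as @ y # us" k "vs @ [x]"] dist' N' k by simp
    moreover have "N - insert k (set (vs @ [z])) = N - insert k (set vs) - {z}" for z by auto
    ultimately show ?thesis using hom[OF k] by simp
  qed
qed

lemma card_le_cost: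
  assumes "\<sigma> \<in> perms n"
  shows "card (B (arr H \<sigma> b)) \<le> cost n H B"
proof -
  have "perms n \<subseteq> {xs. set xs \<subseteq> {1..n} \<and> distinct xs}"
    by (auto simp: perms_def)
  then have "finite (perms n)"
    using finite_subset finite_subset_distinct by blast
  then show ?thesis
    unfolding cost_def using assms by (intro Max_ge) auto
qed

theorem theorem4:
  fixes n :: nat
    and H :: "nat \<Rightarrow> nat set \<Rightarrow> bool"
    and B :: "(nat \<Rightarrow> bool) \<Rightarrow> nat set"
  assumes "n \<ge> 1"
    and "\<forall>v. B v \<subseteq> {1..n}"
    and "valid n H B"
  shows "log 2 (real n) / 2 \<le> real (cost n H B)"
proof -
  define N where "N = {1..n}"
  obtain m where m: "2 ^ m \<le> n" "n < 2 ^ (m + 1)"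
    using ex_power_ivl1[of 2 n] assms(1) by auto
  obtain xs y where xs: "length xs = m" "distinct (y # xs)" "set (y # xs) \<subseteq> N"
    and hom: "\<And>i z. i < m \<Longrightarrow> z \<in> set (drop (Suc i) xs) \<Longrightarrow>
      H (xs ! i) (N - set (take (Suc i) xs) - {z}) = H (xs ! i) (N - set (take (Suc i) xs) - {y})"
    using end_homogeneous_sequence[of N m H N] m(1) unfolding N_def by auto
  obtain R where R: "set R = N - set (y # xs)" "distinct R"
    using finite_distinct_list[of "N - set (y # xs)"] unfolding N_def by auto
  \<comment> \<open>The bit at \<open>y\<close> once \<open>y\<close> has taken the place of
    \<open>xs ! i\<close>; \<open>b\<close> is its majority value over \<open>i\<close>.\<close>
  obtain b where b: "m \<le> 2 * card {i\<in>{..<m}. H y (N - set (take (Suc i) xs) - {y}) = b}"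
    (is "_ \<le> 2 * card ?I")
    using majority_bool[of "{..<m}" "\<lambda>i. H y (N - set (take (Suc i) xs) - {y})"] by auto
  \<comment> \<open>Reversed, so that the locations not before \<open>xs ! i\<close> are exactly
    \<open>take (Suc i) xs\<close> and \<open>y\<close>, as in \<open>hom\<close>.\<close>
  define \<sigma> where "\<sigma> = R @ rev xs @ [y]"
  have \<sigma>: "\<sigma> \<in> perms n" "last \<sigma> = y"
    using xs R by (auto simp: \<sigma>_def perms_def N_def)
  have "xs ! i \<in> B (arr H \<sigma> b)" if "i \<in> ?I" for i
  proof -
    define as x bs where "as = rev (drop (Suc i) xs)" and "x = xs ! i" and "bs = rev (take i xs)"
    have "xs = take i xs @ x # drop (Suc i) xs"
      unfolding x_def using that xs(1) by (intro id_take_nth_drop) simp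
    then have "rev xs = rev (take i xs @ x # drop (Suc i) xs)" by (rule arg_cong)
    also have "\<dots> = as @ x # bs" by (simp add: as_def bs_def)
    finally have "rev xs = as @ x # bs" .
    then have eq: "\<sigma> = R @ as @ x # bs @ [y]"
      by (simp add: \<sigma>_def)
    have tk: "set (take (Suc i) xs) = insert x (set bs)"
      using that xs(1) by (simp add: take_Suc_conv_app_nth x_def bs_def)
    have "arr H (R @ as @ y # bs @ [x]) (H x (N - insert x (set bs) - {y})) = arr H \<sigma> b"
      unfolding eq
    proof (rule arr_eqI_exchange)
      show "distinct (R @ as @ x # bs @ [y])" "N = set (R @ as @ x # bs @ [y])"
        using \<sigma>(1) eq by (auto simp: perms_def N_def)
      show "b = H y (N - insert x (set bs) - {y})"
        using that tk by auto
    next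
      fix us z vs
      assume "bs = us @ z # vs"
      then have ts: "take i xs = rev vs @ z # rev us"
        by (simp add: bs_def rev_eq_append_conv)
      \<comment> \<open>The index of \<open>z\<close> in \<open>xs\<close>: as \<open>bs\<close> is
        reversed, \<open>vs\<close> holds the smaller indices, while \<open>x\<close> has the larger
        index \<open>i\<close>.\<close>
      define l where "l = length vs"
      have l: "l < i"
        using arg_cong[OF ts, of length] that xs(1) by (simp add: l_def)
      have "take (Suc l) (take i xs) = rev vs @ [z]" "take i xs ! l = z"
        unfolding ts l_def by (simp_all add: nth_append)
      then have "take (Suc l) xs = rev vs @ [z]" "xs ! l = z"
        using l by (simp_all add: min_def split: if_splits)
      moreover have "x \<in> set (drop (Suc l) xs)"
        unfolding x_def in_set_conv_nth using l that xs(1)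
        by (intro exI[of _ "i - Suc l"]) auto
      ultimately show "H z (N - insert z (set vs) - {x}) = H z (N - insert z (set vs) - {y})"
        using hom[of l x] l that by simp
    qed simp
    moreover have "R @ as @ y # bs @ [x] \<in> perms n"
      using \<sigma>(1) unfolding eq perms_def by auto
    moreover have "last (R @ as @ y # bs @ [x]) = x" by simp
    ultimately show ?thesis
      using assms(3) unfolding valid_def x_def by metis
  qed
  moreover have "y \<in> B (arr H \<sigma> b)"
    using assms(3) \<sigma> unfolding valid_def by metis
  ultimately have sub: "insert y ((!) xs ` ?I) \<subseteq> B (arr H \<sigma> b)" by blast
  have "card ((!) xs ` ?I) = card ?I"
    using xs by (intro card_image inj_on_nth) auto
  moreover have "y \<notin> (!) xs ` ?I" using xs by auto
  ultimately have "Suc (card ?I) = card (insert y ((!) xs ` ?I))" by simp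
  also have "\<dots> \<le> card (B (arr H \<sigma> b))"
    using sub assms(2) by (meson card_mono finite_atLeastAtMost finite_subset)
  also have "\<dots> \<le> cost n H B" by (rule card_le_cost[OF \<sigma>(1)])
  \<comment> \<open>Counting \<open>y\<close> contributes the 2, which absorbs the loss from
    rounding the logarithm down to \<open>m\<close>.\<close>
  finally have "m + 2 \<le> 2 * cost n H B" using b by linarith
  moreover have "log 2 (real n) \<le> m + 1"
    using log2_of_power_le[of n "m + 1"] m(2) assms(1) by simp
  ultimately show ?thesis by linarith
qed

end
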